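(* Let $R>0$ be a real number. Then $$\limsup_{\kappa\to 1-}\ \sup\left\{\frac{2R}{1-\kappa}-\operatorname{diam} I\ \middle|\ I\subset\mathbb{R}\text{ Borel},\ Q(R,I,\kappa)\le 1\right\}\le 2R,$$ where $$Q(R,I,\kappa):=\sup_{X\in\mathcal{X}}\frac{\min\{R,\operatorname{ObsDiam}(X;-\kappa)\}}{\operatorname{ObsDiam}(X,I;-\kappa)}.$$
   Context: An mm-space is a triple $(X,d_X,\mu_X)$ (written $X$) where $d_X$ is a complete separable metric on $X$ and $\mu_X$ is a Borel probability measure on $(X,d_X)$ with full support. $\mathcal{X}$ denotes the set of all mm-spaces up to mm-isomorphism (measure-preserving isometry). For metric spaces $X,Y$, $\operatorname{Lip}_1(X,Y)$ is the set of 1-Lipschitz maps $f\colon X\to Y$, i.e. $d_Y(f(x),f(y))\le d_X(x,y)$ for all $x,y\in X$. For a Borel probability measure $\mu$ on a metric space $Y$ and a real number $\alpha\le 1$, $\operatorname{PartDiam}(\mu;\alpha)$ is the infimum of the diameters of all Borel subsets $A\subset Y$ with $\mu(A)\ge\alpha$. For an mm-space $X$, a metric space $Y$ and $\kappa\ge 0$, the observable diameter with screen $Y$ is $$\operatorname{ObsDiam}(X,Y;-\kappa)=\sup\{\operatorname{PartDiam}(f_*\mu_X;1-\kappa)\mid f\in\operatorname{Lip}_1(X,Y)\},$$ where $f_*\mu_X$ is the push-forward, and $\operatorname{ObsDiam}(X;-\kappa)=\operatorname{ObsDiam}(X,\mathbb{R};-\kappa)$. A Borel set $I\subset\mathbb{R}$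 is regarded as a metric space with the Euclidean metric. Conventions: all suprema are taken in $[-\infty,\infty]$, with the supremum defining an observable diameter taken in $[0,\infty]$ (so it is $0$ if there is no map); in the quotient defining $Q$, $a/0=+\infty$ for $a>0$ and $0/0=0$; $\operatorname{diam} I$ may be $+\infty$, in which case $\frac{2R}{1-\kappa}-\operatorname{diam} I=-\infty$. *)

theory Defs
  imports "HOL-Probability.Probability"
begin

definition metric_borel :: "'a metric \<Rightarrow> 'a measure" where
  "metric_borel m = sigma (mspace m) {U. openin (mtopology_of m) U}"

(* The library's diameter is real-valued and 0 on unbounded sets; this one is infinite there. *)
definition ediam :: "'a metric \<Rightarrow> 'a set \<Rightarrow> ennreal" where
  "ediam m A = (SUP x\<in>A. SUP y\<in>A. ennreal (mdist m x y))"

definition lip1 :: "'a metric \<Rightarrow> 'b metric \<Rightarrow> ('a \<Rightarrow> 'b) set" where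
  "lip1 m m' = {f \<in> mspace m \<rightarrow> mspace m'.
     \<forall>x\<in>mspace m. \<forall>y\<in>mspace m. mdist m' (f x) (f y) \<le> mdist m x y}"

definition mm_space :: "'a metric \<times> 'a measure \<Rightarrow> bool" where
  "mm_space = (\<lambda>(m, \<mu>). mcomplete_of m \<and> separable_space (mtopology_of m) \<and>
     prob_space \<mu> \<and> sets \<mu> = sets (metric_borel m) \<and>
     (\<forall>U. openin (mtopology_of m) U \<and> U \<noteq> {} \<longrightarrow> 0 < measure \<mu> U))"

definition mm_isomorphic :: "'a metric \<times> 'a measure \<Rightarrow> 'b metric \<times> 'b measure \<Rightarrow> bool" where
  "mm_isomorphic = (\<lambda>(m, \<mu>) (m', \<mu>'). \<exists>\<phi>. bij_betw \<phi> (mspace m) (mspace m') \<and>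
     (\<forall>x\<in>mspace m. \<forall>y\<in>mspace m. mdist m' (\<phi> x) (\<phi> y) = mdist m x y) \<and>
     distr \<mu> (metric_borel m') \<phi> = \<mu>')"

definition part_diam :: "'a metric \<Rightarrow> 'a measure \<Rightarrow> real \<Rightarrow> ennreal" where
  "part_diam m \<mu> \<alpha> = (INF A\<in>{A \<in> sets (metric_borel m). \<alpha> \<le> measure \<mu> A}. ediam m A)"

(* The paper writes ObsDiam(X,Y;-kappa); the third argument here is kappa. *)
definition obs_diam_screen :: "'a metric \<times> 'a measure \<Rightarrow> 'b metric \<Rightarrow> real \<Rightarrow> ennreal" where
  "obs_diam_screen X Y \<kappa> =
     (SUP f\<in>lip1 (fst X) Y. part_diam Y (distr (snd X) (metric_borel Y) f) (1 - \<kappa>))"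

definition obs_diam :: "'a metric \<times> 'a measure \<Rightarrow> real \<Rightarrow> ennreal" where
  "obs_diam X \<kappa> = obs_diam_screen X (euclidean_metric :: real metric) \<kappa>"

(* A complete separable metric space has at most the cardinality of the continuum, so up to
   mm-isomorphism its carrier is a set of reals, with an arbitrary metric unrelated to the
   Euclidean one. The lemmas mm_space_isomorphic_real and obs_diam_screen_isomorphic below
   show that this loses no mm-space and that the choice of representative is immaterial. *)
definition mm_spaces :: "(real metric \<times> real measure) set" where
  "mm_spaces = {X. mm_space X}"

(* Division in ennreal satisfies a / 0 = \<infinity> for a > 0, 0 / 0 = 0 and a / \<infinity> = 0. *)
definition obs_ratio :: "real \<Rightarrow> real set \<Rightarrow> real \<Rightarrow> ennreal" where
  "obs_ratio R I \<kappa> = (SUP X\<in>mm_spaces.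
     min (ennreal R) (obs_diam X \<kappa>) / obs_diam_screen X (submetric euclidean_metric I) \<kappa>)"


lemma space_metric_borel [simp]: "space (metric_borel m) = mspace m"
  and sets_metric_borel: "sets (metric_borel m) = sigma_sets (mspace m) {U. openin (mtopology_of m) U}"
proof -
  have "{U. openin (mtopology_of m) U} \<subseteq> Pow (mspace m)"
    using openin_subset by fastforce
  then show "space (metric_borel m) = mspace m"
    and "sets (metric_borel m) = sigma_sets (mspace m) {U. openin (mtopology_of m) U}"
    by (simp_all add: metric_borel_def)
qed

lemma metric_borel_euclidean: "metric_borel (euclidean_metric :: 'a::metric_space metric) = borel"
  by (simp add: metric_borel_def borel_def)

lemma metric_borel_submetric_euclidean:
  assumes "I \<in> sets borel"
  shows "sets (metric_borel (submetric euclidean_metric I)) = sets (restrict_space (borel :: 'a::metric_space measure) I)"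
proof -
  have "{U. openin (top_of_set I) U} = (\<inter>) I ` {S. open S}"
    by (auto simp: openin_open)
  moreover have "I \<in> sigma_sets UNIV {S. open S}"
    using assms by (simp add: borel_def)
  ultimately show ?thesis
    by (simp add: sets_metric_borel mtopology_of_submetric sets_restrict_space borel_def
        sigma_sets_Int)
qed

lemma lip1_imp_continuous_map:
  assumes "f \<in> lip1 m m'"
  shows "continuous_map (mtopology_of m) (mtopology_of m') f"
proof -
  have "Lipschitz_continuous_map m m' f"
    using assms by (auto simp: lip1_def Lipschitz_continuous_map_def intro!: exI[of _ 1])
  then show ?thesis
    by (rule Lipschitz_continuous_imp_continuous_map)
qed

lemma measurable_lip1:
  assumes "f \<in> lip1 m m'"
  shows "f \<in> measurable (metric_borel m) (metric_borel m')"
proof (rule measurable_sigma_sets[OF sets_metric_borel])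
  show "{U. openin (mtopology_of m') U} \<subseteq> Pow (mspace m')"
    using openin_subset by fastforce
  show "f \<in> space (metric_borel m) \<rightarrow> mspace m'"
    using assms by (auto simp: lip1_def)
  fix U assume "U \<in> {U. openin (mtopology_of m') U}"
  then have "openin (mtopology_of m) {x \<in> mspace m. f x \<in> U}"
    using lip1_imp_continuous_map[OF assms] by (auto simp: continuous_map_def)
  moreover have "f -` U \<inter> space (metric_borel m) = {x \<in> mspace m. f x \<in> U}"
    by auto
  ultimately show "f -` U \<inter> space (metric_borel m) \<in> sets (metric_borel m)"
    by (simp add: sets_metric_borel)
qed

lemma lip1_comp:
  assumes "f \<in> lip1 m m'" "g \<in> lip1 m' m''"
  shows "g \<circ> f \<in> lip1 m m''"
  proof -
  have "mdist m'' (g (f x)) (g (f y)) \<le> mdist m x y" if "x \<in> mspace m" "y \<in> mspace m" for x y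
  proof -
    have "mdist m'' (g (f x)) (g (f y)) \<le> mdist m' (f x) (f y)"
      using assms that by (auto simp: lip1_def Pi_iff)
    also have "\<dots> \<le> mdist m x y"
      using assms that by (auto simp: lip1_def)
    finally show ?thesis .
  qed
  then show ?thesis
    using assms by (auto simp: lip1_def)
qed

lemma obs_diam_screen_mono_map:
  assumes "\<phi> \<in> lip1 m m'" "sets \<mu> = sets (metric_borel m)" "distr \<mu> (metric_borel m') \<phi> = \<mu>'"
  shows "obs_diam_screen (m', \<mu>') Y \<kappa> \<le> obs_diam_screen (m, \<mu>) Y \<kappa>"
  unfolding obs_diam_screen_def fst_conv snd_conv
proof (rule SUP_mono)
  fix f assume f: "f \<in> lip1 m' Y"
  have "\<phi> \<in> measurable \<mu> (metric_borel m')"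
    using measurable_lip1[OF assms(1)] measurable_cong_sets[OF assms(2) refl] by blast
  then have "distr \<mu>' (metric_borel Y) f = distr \<mu> (metric_borel Y) (f \<circ> \<phi>)"
    using measurable_lip1[OF f] by (simp add: assms(3)[symmetric] distr_distr)
  with lip1_comp[OF assms(1) f]
  show "\<exists>g\<in>lip1 m Y. part_diam Y (distr \<mu>' (metric_borel Y) f) (1 - \<kappa>)
      \<le> part_diam Y (distr \<mu> (metric_borel Y) g) (1 - \<kappa>)"
    by (intro bexI[of _ "f \<circ> \<phi>"]) auto
qed

lemma mm_isomorphic_sym:
  assumes "mm_space X" "mm_isomorphic X X'"
  shows "mm_isomorphic X' X"
proof -
  obtain m \<mu> m' \<mu>' where X: "X = (m, \<mu>)" "X' = (m', \<mu>')" by (cases X, cases X')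
  from assms(2) obtain \<phi> where \<phi>: "bij_betw \<phi> (mspace m) (mspace m')"
    "\<And>x y. x \<in> mspace m \<Longrightarrow> y \<in> mspace m \<Longrightarrow> mdist m' (\<phi> x) (\<phi> y) = mdist m x y"
    "distr \<mu> (metric_borel m') \<phi> = \<mu>'"
    by (auto simp: X mm_isomorphic_def)
  define \<psi> where "\<psi> = inv_into (mspace m) \<phi>"
  have \<psi>: "bij_betw \<psi> (mspace m') (mspace m)"
    by (simp add: \<psi>_def \<phi>(1) bij_betw_inv_into)
  have inv: "\<phi> (\<psi> y) = y" "\<psi> y \<in> mspace m" if "y \<in> mspace m'" for y
    using that \<phi>(1) \<psi> by (auto simp: \<psi>_def bij_betw_inv_into_right bij_betwE)
  have inv': "\<psi> (\<phi> x) = x" if "x \<in> mspace m" for x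
    using that \<phi>(1) by (simp add: \<psi>_def bij_betw_inv_into_left)
  have iso: "mdist m (\<psi> x) (\<psi> y) = mdist m' x y" if "x \<in> mspace m'" "y \<in> mspace m'" for x y
    using \<phi>(2)[of "\<psi> x" "\<psi> y"] inv that by simp
  have s: "sets \<mu> = sets (metric_borel m)"
    using assms(1) by (simp add: X mm_space_def)
  have "\<phi> \<in> lip1 m m'" "\<psi> \<in> lip1 m' m"
    using \<phi> \<psi> iso by (auto simp: lip1_def bij_betwE)
  then have meas: "\<phi> \<in> measurable \<mu> (metric_borel m')"
      "\<psi> \<in> measurable (metric_borel m') (metric_borel m)"
    using measurable_lip1 measurable_cong_sets[OF s refl] by blast+
  have sp: "space \<mu> = mspace m"
    using sets_eq_imp_space_eq[OF s] by simp
  have "distr \<mu>' (metric_borel m) \<psi> = distr \<mu> (metric_borel m) (\<psi> \<circ> \<phi>)"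
    using meas by (simp add: \<phi>(3)[symmetric] distr_distr)
  also have "\<dots> = distr \<mu> \<mu> (\<lambda>x. x)"
    using s inv' sp by (intro distr_cong) auto
  also have "\<dots> = \<mu>" by simp
  finally show ?thesis
    using \<psi> iso by (auto simp: X mm_isomorphic_def)
qed

lemma obs_diam_screen_isomorphic_le:
  assumes "mm_isomorphic X X'" "sets (snd X) = sets (metric_borel (fst X))"
  shows "obs_diam_screen X' Y \<kappa> \<le> obs_diam_screen X Y \<kappa>"
proof -
  obtain m \<mu> m' \<mu>' where X: "X = (m, \<mu>)" "X' = (m', \<mu>')" by (cases X, cases X')
  from assms(1) obtain \<phi> where \<phi>: "bij_betw \<phi> (mspace m) (mspace m')"
    "\<forall>x\<in>mspace m. \<forall>y\<in>mspace m. mdist m' (\<phi> x) (\<phi> y) = mdist m x y"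
    "distr \<mu> (metric_borel m') \<phi> = \<mu>'"
    by (auto simp: X mm_isomorphic_def)
  have "\<phi> \<in> lip1 m m'"
    using \<phi> by (auto simp: lip1_def bij_betwE)
  moreover have "sets \<mu> = sets (metric_borel m)"
    using assms(2) by (simp add: X)
  ultimately show ?thesis
    unfolding X by (rule obs_diam_screen_mono_map[OF _ _ \<phi>(3)])
qed

lemma obs_diam_screen_isomorphic:
  assumes "mm_space X" "mm_isomorphic X X'"
  shows "obs_diam_screen X' Y \<kappa> = obs_diam_screen X Y \<kappa>"
proof (rule antisym)
  have "sets (snd X) = sets (metric_borel (fst X))"
    using assms(1) by (cases X) (simp add: mm_space_def)
  then show "obs_diam_screen X' Y \<kappa> \<le> obs_diam_screen X Y \<kappa>"
    by (rule obs_diam_screen_isomorphic_le[OF assms(2)])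
  have "sets (snd X') = sets (metric_borel (fst X'))"
    using assms(2) by (cases X, cases X') (auto simp: mm_isomorphic_def)
  then show "obs_diam_screen X Y \<kappa> \<le> obs_diam_screen X' Y \<kappa>"
    by (rule obs_diam_screen_isomorphic_le[OF mm_isomorphic_sym[OF assms]])
qed

lemma separable_metric_inj_real:
  assumes "separable_space (mtopology_of m)"
  obtains \<phi> :: "'a \<Rightarrow> real" where "inj_on \<phi> (mspace m)"
proof -
  interpret Metric_space "mspace m" "mdist m" by simp
  obtain C where C: "countable C" "C \<subseteq> mspace m" "mtopology closure_of C = mspace m"
    using assms by (auto simp: separable_space_def mtopology_of_def)
  define c where "c = from_nat_into C"
  define g where "g = (\<lambda>x. {n. mdist m x (c (fst (prod_decode n))) < inverse (Suc (snd (prod_decode n)))})"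
  have "inj_on g (mspace m)"
  proof (rule inj_onI, rule ccontr)
    fix x y assume xy: "x \<in> mspace m" "y \<in> mspace m" "g x = g y" "x \<noteq> y"
    then have "0 < mdist m x y / 2" by simp
    then obtain l where l: "inverse (Suc l) < mdist m x y / 2"
      using reals_Archimedean by blast
    have "x \<in> mtopology closure_of C" using C xy by simp
    then obtain z where z: "z \<in> C" "mdist m x z < inverse (Suc l)"
      unfolding metric_closure_of by (fastforce dest: spec[of _ "inverse (Suc l)"])
    obtain k where k: "c k = z"
      using from_nat_into_surj[OF C(1) z(1)] by (auto simp: c_def)
    have "prod_encode (k, l) \<in> g x" using z k by (simp add: g_def)
    then have "prod_encode (k, l) \<in> g y" using xy by simp
    then have "mdist m y z < inverse (Suc l)" using k by (simp add: g_def)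
    moreover have "mdist m x y \<le> mdist m x z + mdist m y z"
      using triangle[of x z y] commute[of z y] xy z C by auto
    ultimately show False using z l by linarith
  qed
  moreover obtain h :: "nat set \<Rightarrow> real" where "inj h"
    using nat_sets_eqpoll_reals by (auto simp: eqpoll_def bij_betw_def)
  ultimately have "inj_on (h \<circ> g) (mspace m)"
    by (meson comp_inj_on inj_on_subset subset_UNIV)
  then show ?thesis by (rule that)
qed

lemma mm_space_isomorphic_real:
  fixes X :: "'a metric \<times> 'a measure"
  assumes "mm_space X"
  shows "\<exists>X'\<in>mm_spaces. mm_isomorphic X X'"
proof -
  obtain m \<mu> where X: "X = (m, \<mu>)" by (cases X)
  have m: "mcomplete_of m" "separable_space (mtopology_of m)" "prob_space \<mu>"
      "sets \<mu> = sets (metric_borel m)"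
    and supp: "\<And>U. openin (mtopology_of m) U \<Longrightarrow> U \<noteq> {} \<Longrightarrow> 0 < measure \<mu> U"
    using assms by (auto simp: X mm_space_def)
  obtain \<phi> :: "'a \<Rightarrow> real" where inj: "inj_on \<phi> (mspace m)"
    using separable_metric_inj_real[OF m(2)] .
  define \<psi> where "\<psi> = inv_into (mspace m) \<phi>"
  define S where "S = \<phi> ` mspace m"
  define d where "d = (\<lambda>a b. mdist m (\<psi> a) (\<psi> b))"
  have \<psi>: "\<psi> (\<phi> x) = x" if "x \<in> mspace m" for x
    using that inj by (simp add: \<psi>_def)
  have \<psi>S: "\<psi> a \<in> mspace m" "\<phi> (\<psi> a) = a" if "a \<in> S" for a
    using that \<psi> by (auto simp: S_def)
  interpret M: Metric_space "mspace m" "mdist m" by simp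
  interpret M': Metric_space S d
  proof
    show "0 \<le> d a b" "d a b = d b a" for a b by (simp_all add: d_def M.commute)
    show "d a b = 0 \<longleftrightarrow> a = b" if "a \<in> S" "b \<in> S" for a b
      using that \<psi>S M.zero by (metis d_def)
    show "d a c \<le> d a b + d b c" if "a \<in> S" "b \<in> S" "c \<in> S" for a b c
      using that \<psi>S M.triangle by (simp add: d_def)
  qed
  define m' where "m' = metric (S, d)"
  have m': "mspace m' = S" "mdist m' = d" by (simp_all add: m'_def)
  have iso: "\<forall>x\<in>mspace m. \<forall>y\<in>mspace m. mdist m' (\<phi> x) (\<phi> y) = mdist m x y"
    using \<psi> by (simp add: m' d_def)
  have bij: "bij_betw \<phi> (mspace m) (mspace m')"
    using inj by (simp add: m' S_def bij_betw_def)
  have lip: "\<phi> \<in> lip1 m m'"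
    using bij iso by (auto simp: lip1_def bij_betwE)
  have meas: "\<phi> \<in> measurable \<mu> (metric_borel m')"
    using measurable_lip1[OF lip] measurable_cong_sets[OF m(4) refl] by blast
  have sp: "space \<mu> = mspace m"
    using sets_eq_imp_space_eq[OF m(4)] by simp
  define \<mu>' where "\<mu>' = distr \<mu> (metric_borel m') \<phi>"
  have "M'.mcomplete"
    unfolding M'.mcomplete_def
  proof (intro allI impI)
    fix \<sigma> assume "M'.MCauchy \<sigma>"
    then have \<sigma>: "\<And>n. \<sigma> n \<in> S"
      and "\<forall>\<epsilon>>0. \<exists>N. \<forall>n n'. N \<le> n \<longrightarrow> N \<le> n' \<longrightarrow> d (\<sigma> n) (\<sigma> n') < \<epsilon>"
      by (auto simp: M'.MCauchy_def)
    then have "M.MCauchy (\<psi> \<circ> \<sigma>)"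
      using \<psi>S(1) by (simp add: M.MCauchy_def d_def image_subset_iff)
    then obtain x where x: "limitin M.mtopology (\<psi> \<circ> \<sigma>) x sequentially"
      using m(1) by (auto simp: mcomplete_of_def M.mcomplete_def)
    then have "limitin M'.mtopology \<sigma> (\<phi> x) sequentially"
      using \<sigma> \<psi> unfolding M.limit_metric_sequentially M'.limit_metric_sequentially
      by (auto simp: d_def S_def) blast
    then show "\<exists>y. limitin M'.mtopology \<sigma> y sequentially" ..
  qed
  then have 1: "mcomplete_of m'" by (simp add: m'_def)
  interpret MM: Metric_space12 "mspace m" "mdist m" S d ..
  have "homeomorphic_map M.mtopology M'.mtopology \<phi>"
    by (rule MM.isometry_imp_homeomorphic_map) (use \<psi> in \<open>auto simp: S_def d_def\<close>)
  then have "M.mtopology homeomorphic_space M'.mtopology"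
    by (rule homeomorphic_map_imp_homeomorphic_space)
  then have 2: "separable_space (mtopology_of m')"
    using m(2) homeomorphic_separable_space by (auto simp: m'_def mtopology_of_def)
  have 3: "prob_space \<mu>'"
    using prob_space.prob_space_distr[OF m(3) meas] by (simp add: \<mu>'_def)
  have 4: "0 < measure \<mu>' U" if U: "openin (mtopology_of m') U" "U \<noteq> {}" for U
  proof -
    have V: "openin (mtopology_of m) {x \<in> mspace m. \<phi> x \<in> U}"
      using lip1_imp_continuous_map[OF lip] U by (auto simp: continuous_map_def)
    have US: "U \<subseteq> S" using openin_subset[OF U(1)] by (simp add: m')
    then have "{x \<in> mspace m. \<phi> x \<in> U} \<noteq> {}" using U(2) by (auto simp: S_def)
    moreover have "measure \<mu>' U = measure \<mu> {x \<in> mspace m. \<phi> x \<in> U}"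
    proof -
      have "\<phi> -` U \<inter> space \<mu> = {x \<in> mspace m. \<phi> x \<in> U}" by (auto simp: sp)
      moreover have "U \<in> sets (metric_borel m')"
        using U(1) by (simp add: sets_metric_borel)
      ultimately show ?thesis using meas by (simp add: \<mu>'_def measure_distr)
    qed
    ultimately show ?thesis using supp[OF V] by simp
  qed
  have "(m', \<mu>') \<in> mm_spaces"
    using 1 2 3 4 by (simp add: mm_spaces_def mm_space_def \<mu>'_def)
  moreover have "mm_isomorphic X (m', \<mu>')"
    using bij iso by (auto simp: X mm_isomorphic_def \<mu>'_def)
  ultimately show ?thesis ..
qed

end

theory Submission
  imports Defs
begin

text \<open>
  Write \<open>\<alpha> = 1 - \<kappa>\<close>. The bound holds for every \<open>\<kappa>\<close> in \<open>(0, 1)\<close>, and one test space proves it: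
  \<open>n = \<lfloor>2 / \<alpha>\<rfloor>\<close> equally weighted points on the line, at consecutive distance \<open>R\<close>.
  This \<open>n\<close> satisfies \<open>1 / n < \<alpha> \<le> 2 / n\<close>, so one point is too light to reach mass \<open>\<alpha>\<close>
  while any two points together do reach it. The first inequality makes the
  observable diameter of the test space at least \<open>R\<close> (\<open>obs_diam_uniform_ge\<close>). Hence, if
  \<open>obs_ratio R I \<kappa> \<le> 1\<close>, for each \<open>D < R\<close> there is a 1-Lipschitz map into \<open>I\<close> whose push-forward
  has partial diameter larger than \<open>D\<close>, and by the second inequality this map keeps any two
  of the points at distance at least \<open>D\<close> (\<open>obs_diam_screen_uniform_gtE\<close>).

  Such a map is rigid. Consecutive points go to points whose distance lies between \<open>D\<close> and \<open>R\<close>;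
  if the map ever turned back, then two points that are two steps apart would land within
  \<open>R - D\<close> of each other, which is less than \<open>D\<close> once \<open>D > R / 2\<close>. So the image is a monotone
  sequence with steps at least \<open>D\<close> (\<open>separated_short_steps_spread\<close>), and \<open>I\<close> has
  diameter at least \<open>(n - 1) D\<close>. As \<open>D\<close> tends to \<open>R\<close>, the diameter is seen to be at least
  \<open>(n - 1) R > 2 R / \<alpha> - 2 R\<close>.
\<close>

lemma sets_metric_borel_finite_submetric:
  fixes S :: "real set"
  assumes "finite S"
  shows "sets (metric_borel (submetric euclidean_metric S)) = Pow S"
proof -
  have "S \<in> sets borel"
    using assms by (simp add: borel_closed finite_imp_closed)
  moreover have "sets (restrict_space borel S) = Pow S"
  proof
    show "sets (restrict_space borel S) \<subseteq> Pow S"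
      by (auto simp: sets_restrict_space)
    show "Pow S \<subseteq> sets (restrict_space borel S)"
    proof
      fix A assume "A \<in> Pow S"
      then have "A \<in> sets borel" "A = S \<inter> A"
        using assms by (auto intro!: borel_closed finite_imp_closed dest: finite_subset)
      then show "A \<in> sets (restrict_space borel S)"
        by (auto simp: sets_restrict_space)
    qed
  qed
  ultimately show ?thesis
    by (simp add: metric_borel_submetric_euclidean)
qed

lemma mm_space_uniform:
  fixes S :: "real set"
  assumes "finite S" "S \<noteq> {}"
  shows "mm_space (submetric euclidean_metric S, uniform_count_measure S)"
proof -
  have "compact_space (mtopology_of (submetric euclidean_metric S))"
    using assms(1) by (simp add: compact_space_def finite_imp_compactin)
  then have "mcomplete_of (submetric euclidean_metric S)"
    unfolding mcomplete_of_def mtopology_of_def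
    by (rule Metric_space.compact_space_imp_mcomplete[OF Metric_space_mspace_mdist])
  moreover have "separable_space (mtopology_of (submetric euclidean_metric S))"
    unfolding separable_space_def
    using assms(1) by (intro exI[of _ S]) (auto simp: countable_finite in_closure_of)
  moreover have "0 < measure (uniform_count_measure S) U"
    if "openin (mtopology_of (submetric euclidean_metric S)) U" "U \<noteq> {}" for U
  proof -
    have "U \<subseteq> S"
      using openin_subset[OF that(1)] by simp
    moreover from this have "0 < card U" "0 < card S"
      using assms that(2) by (auto simp: card_gt_0_iff dest: finite_subset)
    ultimately show ?thesis
      using assms(1) by (simp add: measure_uniform_count_measure)
  qed
  ultimately show ?thesis
    using assms
    by (simp add: mm_space_def prob_space_uniform_count_measure sets_uniform_count_measure
        sets_metric_borel_finite_submetric)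
qed

lemma ediam_upper: "x \<in> A \<Longrightarrow> y \<in> A \<Longrightarrow> ennreal (mdist m x y) \<le> ediam m A"
  unfolding ediam_def by (rule SUP_upper2[of x], assumption, rule SUP_upper)

lemma measurable_uniform_lip1:
  fixes S :: "real set"
  assumes "finite S" "f \<in> lip1 (submetric euclidean_metric S) Y"
  shows "f \<in> measurable (uniform_count_measure S) (metric_borel Y)"
proof -
  have "sets (uniform_count_measure S) = sets (metric_borel (submetric euclidean_metric S))"
    using assms(1) by (simp add: sets_uniform_count_measure sets_metric_borel_finite_submetric)
  then show ?thesis
    using measurable_lip1[OF assms(2)] measurable_cong_sets by blast
qed

lemma measure_distr_uniform_lip1:
  fixes S :: "real set"
  assumes "finite S" "f \<in> lip1 (submetric euclidean_metric S) Y" "A \<in> sets (metric_borel Y)"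
  shows "measure (distr (uniform_count_measure S) (metric_borel Y) f) A
    = card {x \<in> S. f x \<in> A} / card S"
proof -
  have "f -` A \<inter> S = {x \<in> S. f x \<in> A}"
    by auto
  then show ?thesis
    using assms measurable_uniform_lip1[OF assms(1,2)]
    by (simp add: measure_distr space_uniform_count_measure measure_uniform_count_measure)
qed

text \<open>When single points weigh less than \<open>1 - \<kappa>\<close>, every admissible set contains two of them;
  the inclusion map into the line is the witness.\<close>
lemma obs_diam_uniform_ge:
  fixes S :: "real set"
  assumes S: "finite S" "1 / card S < 1 - \<kappa>"
    and sep: "\<And>x y. x \<in> S \<Longrightarrow> y \<in> S \<Longrightarrow> x \<noteq> y \<Longrightarrow> R \<le> dist x y"
  shows "ennreal R \<le> obs_diam (submetric euclidean_metric S, uniform_count_measure S) \<kappa>"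
proof -
  let ?E = "euclidean_metric :: real metric"
  have lip: "id \<in> lip1 (submetric ?E S) ?E"
    by (simp add: lip1_def)
  have "ennreal R \<le> ediam ?E A"
    if A: "A \<in> sets (metric_borel ?E)"
      "1 - \<kappa> \<le> measure (distr (uniform_count_measure S) (metric_borel ?E) id) A" for A
  proof -
    have "1 / card S < card {x \<in> S. x \<in> A} / card S"
      using A S(2) measure_distr_uniform_lip1[OF S(1) lip A(1)] by simp
    then have "1 < card {x \<in> S. x \<in> A}"
      by (simp add: divide_less_cancel split: if_splits)
    then obtain x y where "x \<in> S" "y \<in> S" "x \<in> A" "y \<in> A" "x \<noteq> y"
      using S(1) by (auto simp: card_le_Suc0_iff_eq not_le[symmetric])
    then show ?thesis
      using sep[of x y] ediam_upper[of x A y ?E] by (auto intro: order_trans[OF ennreal_leI])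
  qed
  then have "ennreal R \<le> part_diam ?E (distr (uniform_count_measure S) (metric_borel ?E) id) (1 - \<kappa>)"
    by (auto simp: part_diam_def intro!: INF_greatest)
  then show ?thesis
    unfolding obs_diam_def obs_diam_screen_def fst_conv snd_conv
    by (rule SUP_upper2[OF lip])
qed

text \<open>When two points already weigh \<open>1 - \<kappa>\<close>, the images of any two points form an
  admissible set for the partial diameter, so their distance bounds it from above.\<close>
lemma obs_diam_screen_uniform_gtE:
  fixes S I :: "real set"
  assumes S: "finite S" "1 - \<kappa> \<le> 2 / card S" and I: "I \<in> sets borel" and D: "0 \<le> D"
    and gt: "ennreal D < obs_diam_screen (submetric euclidean_metric S, uniform_count_measure S)
      (submetric euclidean_metric I) \<kappa>"
  obtains f where "f \<in> lip1 (submetric euclidean_metric S) (submetric euclidean_metric I)"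
    "\<And>x y. x \<in> S \<Longrightarrow> y \<in> S \<Longrightarrow> x \<noteq> y \<Longrightarrow> D \<le> dist (f x) (f y)"
proof -
  let ?Y = "submetric euclidean_metric I"
  obtain f where f: "f \<in> lip1 (submetric euclidean_metric S) ?Y"
    and gtf: "ennreal D < part_diam ?Y (distr (uniform_count_measure S) (metric_borel ?Y) f) (1 - \<kappa>)"
    using gt by (auto simp: obs_diam_screen_def less_SUP_iff)
  have "D \<le> dist (f x) (f y)" if xy: "x \<in> S" "y \<in> S" "x \<noteq> y" for x y
  proof -
    have fI: "{f x, f y} \<subseteq> I"
      using f xy by (auto simp: lip1_def)
    have A: "{f x, f y} \<in> sets (metric_borel ?Y)"
    proof -
      have "{f x, f y} = I \<inter> {f x, f y}" "{f x, f y} \<in> sets borel"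
        using fI by (auto intro!: borel_closed finite_imp_closed)
      then show ?thesis
        unfolding metric_borel_submetric_euclidean[OF I] sets_restrict_space by blast
    qed
    have "card {x, y} \<le> card {z \<in> S. f z \<in> {f x, f y}}"
      using S(1) xy by (intro card_mono) auto
    then have "2 \<le> card {z \<in> S. f z \<in> {f x, f y}}"
      using xy(3) by simp
    then have "2 / card S \<le> card {z \<in> S. f z \<in> {f x, f y}} / card S"
      by (intro divide_right_mono) linarith+
    then have "1 - \<kappa> \<le> measure (distr (uniform_count_measure S) (metric_borel ?Y) f) {f x, f y}"
      using S(2) measure_distr_uniform_lip1[OF S(1) f A] by linarith
    with A have "part_diam ?Y (distr (uniform_count_measure S) (metric_borel ?Y) f) (1 - \<kappa>)
        \<le> ediam ?Y {f x, f y}"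
      unfolding part_diam_def by (intro INF_lower) simp
    also have "\<dots> \<le> ennreal (dist (f x) (f y))"
      by (auto simp: ediam_def dist_commute intro!: SUP_least)
    finally show ?thesis
      using gtf D by (metis ennreal_le_iff2 less_le_trans order_less_imp_le not_less zero_le_dist)
  qed
  with f show ?thesis
    by (rule that)
qed

text \<open>A turn would bring two terms within \<open>R - D < D\<close> of each other, so all the steps go in the
  same direction.\<close>
lemma separated_short_steps_spread:
  fixes y :: "nat \<Rightarrow> real"
  assumes RD: "R < 2 * D" "0 < D"
    and sep: "\<And>i j. i \<le> n \<Longrightarrow> j \<le> n \<Longrightarrow> i \<noteq> j \<Longrightarrow> D \<le> dist (y i) (y j)"
    and step: "\<And>i. i < n \<Longrightarrow> dist (y i) (y (Suc i)) \<le> R"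
  shows "real n * D \<le> dist (y 0) (y n)"
proof -
  have mono: "real n * D \<le> z n - z 0"
    if sep: "\<And>i j. i \<le> n \<Longrightarrow> j \<le> n \<Longrightarrow> i \<noteq> j \<Longrightarrow> D \<le> \<bar>z i - z j\<bar>"
      and step: "\<And>i. i < n \<Longrightarrow> \<bar>z i - z (Suc i)\<bar> \<le> R"
      and up: "z 0 \<le> z 1" for z :: "nat \<Rightarrow> real"
  proof -
    have inc: "i < n \<Longrightarrow> D \<le> z (Suc i) - z i" for i
    proof (induction i)
      case 0
      then show ?case
        using sep[of 1 0] up by simp
    next
      case (Suc i)
      then show ?case
        using sep[of "Suc (Suc i)" "Suc i"] sep[of "Suc (Suc i)" i] step[of i] step[of "Suc i"] RD
        by auto
    qed
    have "k \<le> n \<Longrightarrow> real k * D \<le> z k - z 0" for k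
    proof (induction k)
      case (Suc k)
      then show ?case
        using inc[of k] by (simp add: algebra_simps)
    qed simp
    then show ?thesis
      by simp
  qed
  show ?thesis
  proof (cases "y 0 \<le> y 1")
    case True
    then show ?thesis
      using mono[of y] sep step by (force simp: dist_real_def)
  next
    case False
    then show ?thesis
      using mono[of "\<lambda>i. - y i"] sep step by (force simp: dist_real_def abs_minus_commute)
  qed
qed

lemma obs_ratio_le_1_imp_min_obs_diam_le:
  assumes "obs_ratio R I \<kappa> \<le> 1" "X \<in> mm_spaces"
  shows "min (ennreal R) (obs_diam X \<kappa>) \<le> obs_diam_screen X (submetric euclidean_metric I) \<kappa>"
    (is "?a \<le> ?b")
proof -
  have le: "?a / ?b \<le> 1"
    using assms by (simp add: obs_ratio_def SUP_le_iff)
  have a: "?a < top"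
    by (simp add: min_less_iff_disj)
  consider "?b = 0" | "?b = top" | "?b \<noteq> 0" "?b < top"
    using less_top by blast
  then show ?thesis
  proof cases
    case 1
    then have "?a = 0"
      using le ennreal_divide_eq_top_iff[of ?a ?b] by (metis neq_top_trans ennreal_one_neq_top)
    then show ?thesis
      by simp
  next
    case 2
    then show ?thesis
      by simp
  next
    case 3
    then have "?a = ?a / ?b * ?b"
      by (simp add: ennreal_divide_times)
    also have "\<dots> \<le> 1 * ?b"
      using le by (rule mult_right_mono) simp
    finally show ?thesis
      by simp
  qed
qed

text \<open>The points \<open>0, R, \<dots>, n R\<close> with equal weights; \<open>n\<close> counts the gaps, so that there are
  \<open>n + 1\<close> points.\<close>
lemma ediam_ge_of_obs_ratio_le_1:
  fixes n :: nat
  assumes R: "R > 0" and I: "I \<in> sets borel" "obs_ratio R I \<kappa> \<le> 1"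
    and n: "1 / (n + 1) < 1 - \<kappa>" "1 - \<kappa> \<le> 2 / (n + 1)" "0 < n"
  shows "ennreal (real n * R) \<le> ediam euclidean_metric I"
proof -
  define p where "p = (\<lambda>i::nat. real i * R)"
  define S where "S = p ` {..n}"
  let ?m = "submetric euclidean_metric S" and ?Y = "submetric euclidean_metric I"
  have dist_p: "dist (p i) (p j) = \<bar>real i - real j\<bar> * R" for i j
    using R by (simp add: p_def dist_real_def abs_mult flip: left_diff_distrib)
  have inj: "inj p"
    using R by (auto simp: p_def inj_def)
  have S: "finite S" "S \<noteq> {}" "card S = n + 1"
    by (auto simp: S_def card_image[OF inj_on_subset[OF inj]])
  have "R \<le> dist x y" if "x \<in> S" "y \<in> S" "x \<noteq> y" for x y
  proof -
    obtain i j where "x = p i" "y = p j" "i \<noteq> j"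
      using \<open>x \<in> S\<close> \<open>y \<in> S\<close> \<open>x \<noteq> y\<close> by (auto simp: S_def)
    moreover from this have "1 \<le> \<bar>real i - real j\<bar>"
      by linarith
    ultimately show ?thesis
      using R by (simp add: dist_p)
  qed
  then have "ennreal R \<le> obs_diam (?m, uniform_count_measure S) \<kappa>"
    using S n by (intro obs_diam_uniform_ge) auto
  moreover have "(?m, uniform_count_measure S) \<in> mm_spaces"
    using S by (simp add: mm_spaces_def mm_space_uniform)
  ultimately have screen: "ennreal R \<le> obs_diam_screen (?m, uniform_count_measure S) ?Y \<kappa>"
    using obs_ratio_le_1_imp_min_obs_diam_le[OF I(2)] by fastforce
  have spread: "ennreal (real n * D) \<le> ediam euclidean_metric I" if D: "R / 2 < D" "D < R" for D
  proof -
    have "ennreal D < obs_diam_screen (?m, uniform_count_measure S) ?Y \<kappa>"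
      using D R screen by (intro less_le_trans[OF _ screen]) (simp add: ennreal_less_iff)
    then obtain f where f: "f \<in> lip1 ?m ?Y"
      and sep: "\<And>x y. x \<in> S \<Longrightarrow> y \<in> S \<Longrightarrow> x \<noteq> y \<Longrightarrow> D \<le> dist (f x) (f y)"
      using obs_diam_screen_uniform_gtE[of S \<kappa> I D] S n I D R by auto
    have "real n * D \<le> dist (f (p 0)) (f (p n))"
    proof (rule separated_short_steps_spread[where y = "\<lambda>i. f (p i)"])
      show "D \<le> dist (f (p i)) (f (p j))" if "i \<le> n" "j \<le> n" "i \<noteq> j" for i j
        using that sep[of "p i" "p j"] inj by (auto simp: S_def inj_eq)
      show "dist (f (p i)) (f (p (Suc i))) \<le> R" if "i < n" for i
      proof -
        have "p i \<in> S" "p (Suc i) \<in> S"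
          using that by (auto simp: S_def)
        then have "dist (f (p i)) (f (p (Suc i))) \<le> dist (p i) (p (Suc i))"
          using f by (auto simp: lip1_def)
        then show ?thesis
          by (simp add: dist_p)
      qed
    qed (use D R in auto)
    moreover have "f (p 0) \<in> I" "f (p n) \<in> I"
      using f by (auto simp: lip1_def S_def)
    ultimately show ?thesis
      using ediam_upper[of "f (p 0)" I "f (p n)" euclidean_metric]
      by (auto intro: order_trans[OF ennreal_leI])
  qed
  show ?thesis
  proof (cases "ediam euclidean_metric I")
    case (real d)
    have "R \<le> d / n"
    proof (rule dense_le_bounded[of "R / 2"])
      show "D \<le> d / n" if "R / 2 < D" "D < R" for D
        using spread[OF that] real n(3) by (simp add: field_simps)
    qed (use R in simp)
    then show ?thesis
      using real n(3) by (simp add: field_simps)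
  qed simp
qed

theorem theorem1p3:
  fixes R :: real
  assumes "R > 0"
  shows "Limsup (at_left 1) (\<lambda>\<kappa> :: real.
           SUP I\<in>{I :: real set. I \<in> sets borel \<and> obs_ratio R I \<kappa> \<le> 1}.
             ereal (2 * R / (1 - \<kappa>)) - enn2ereal (ediam euclidean_metric I))
         \<le> ereal (2 * R)"
proof (rule Limsup_bounded)
  have bound: "ereal (2 * R / (1 - \<kappa>)) - enn2ereal (ediam euclidean_metric I) \<le> ereal (2 * R)"
    if \<kappa>: "0 < \<kappa>" "\<kappa> < 1" and I: "I \<in> sets borel" "obs_ratio R I \<kappa> \<le> 1" for \<kappa> I
  proof -
    \<comment> \<open>The number of gaps between \<open>\<lfloor>2 / (1 - \<kappa>)\<rfloor>\<close> points, the largest number of equally weighted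
      points any two of which have total mass at least \<open>1 - \<kappa>\<close>.\<close>
    define n where "n = nat (\<lfloor>2 / (1 - \<kappa>)\<rfloor> - 1)"
    have "2 < 2 / (1 - \<kappa>)"
      using \<kappa> by (simp add: field_simps)
    then have n: "0 < n" "real n + 1 \<le> 2 / (1 - \<kappa>)" "2 / (1 - \<kappa>) < real n + 2"
      unfolding n_def by linarith+
    have "1 < (real n + 1) * (1 - \<kappa>)"
    proof -
      have "1 < 1 / (1 - \<kappa>)"
        using \<kappa> by (simp add: field_simps)
      then have "1 / (1 - \<kappa>) < real n + 1"
        using n by linarith
      then show ?thesis
        using \<kappa> by (simp add: field_simps)
    qed
    then have "ennreal (real n * R) \<le> ediam euclidean_metric I"
      using n \<kappa> I by (intro ediam_ge_of_obs_ratio_le_1[OF assms, of I \<kappa> n]) (simp_all add: field_simps)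
    moreover have "2 * R / (1 - \<kappa>) \<le> real n * R + 2 * R"
      using mult_right_mono[of "2 / (1 - \<kappa>)" "real n + 2" R] n assms by (simp add: algebra_simps)
    ultimately show ?thesis
      by (cases "ediam euclidean_metric I") (auto simp: ennreal_le_iff2 enn2ereal_ennreal)
  qed
  have "eventually (\<lambda>\<kappa>::real. \<kappa> \<in> {0<..<1}) (at_left 1)"
    by (rule eventually_at_left_real) simp
  then show "\<forall>\<^sub>F \<kappa> in at_left 1.
      (SUP I\<in>{I :: real set. I \<in> sets borel \<and> obs_ratio R I \<kappa> \<le> 1}.
        ereal (2 * R / (1 - \<kappa>)) - enn2ereal (ediam euclidean_metric I)) \<le> ereal (2 * R)"
    by eventually_elim (auto intro!: SUP_least bound)
qed

end
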